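(* Let $A$ and $B$ be nonempty finite subsets of an abelian group $G$, with $|A| = |B|$ and $1 \notin B$. Let $\rho$ be the right partition number of $(A,B)$. Assume that $\rho < \infty$. Then $\rho$ equals the maximum value of $$\left\lceil \frac{|R \setminus \{1\}|}{|A| - |S|} \right\rceil,$$ where $S$ and $R$ range over all subsets of $A$ and $B \cup \{1\}$, respectively, such that $SR = S$ and $S \neq A$.
   Context: The group $G$ is written multiplicatively with identity $1$. For subsets $S,T \subseteq G$, $ST = \{st : s \in S,\ t \in T\}$ (so $ST = \emptyset$ if $S$ or $T$ is empty), and $Sx = S\{x\}$ for $x \in G$. For $S \subseteq A$ let $U_S = \{b \in B : Sb \subseteq A\}$. The right partition number $\rho = \rho(A,B)$ is defined as follows: if $Ax \neq A$ for all $x \in B$, then $\rho$ is the maximum value of $\left\lceil \frac{|U_S|}{|A| - |S|} \right\rceil$, where $S$ ranges over all proper subsets of $A$ (including $\emptyset$); if $Ax = A$ for some $x \in B$, then $\rho = \infty$. *)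

theory Defs
  imports Complex_Main "HOL-Algebra.Coset" "HOL-Library.Extended_Nat"
begin

definition right_translates_into ::
  "('a, 'm) monoid_scheme \<Rightarrow> 'a set \<Rightarrow> 'a set \<Rightarrow> 'a set \<Rightarrow> 'a set" where
  "right_translates_into G A B S = {b \<in> B. S #>\<^bsub>G\<^esub> b \<subseteq> A}"

text \<open>For a finite set \<open>A\<close> every proper subset \<open>S\<close> of \<open>A\<close> has
  \<open>card S < card A\<close>, so the denominator below is positive, and \<open>nat\<close> is only a change of type.
  The proper subsets of a nonempty finite \<open>A\<close> form a finite nonempty set, so \<open>Max\<close> is a
  genuine maximum.\<close>

definition right_partition_number ::
  "('a, 'm) monoid_scheme \<Rightarrow> 'a set \<Rightarrow> 'a set \<Rightarrow> enat" where
  "right_partition_number G A B =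
    (if \<exists>x\<in>B. A #>\<^bsub>G\<^esub> x = A then \<infinity>
     else enat (Max {nat \<lceil>real (card (right_translates_into G A B S)) /
                         (real (card A) - real (card S))\<rceil> | S. S \<subset> A}))"

end

theory Submission imports Defs
begin

text \<open>The pair \<open>({}, B \<union> {1})\<close> gives the value 1. If \<open>S\<close> attains \<open>\<rho> \<ge> 2\<close>, put
  \<open>R = U\<^sub>S \<union> {1}\<close>, so that \<open>SR \<subseteq> A\<close>. Repeated Dyson transforms \<open>(S, R) \<mapsto> (S \<union> sR, R \<inter> s\<^sup>-\<^sup>1S)\<close> with \<open>s \<in> S\<close> keep \<open>|S| + |R|\<close> fixed, keep
  \<open>1 \<in> R\<close>, do not enlarge \<open>SR\<close>, and shrink \<open>R\<close> until \<open>SR = S\<close>. Since the numerator and the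
  denominator of \<open>|R - {1}| / (|A| - |S|) \<ge> 1\<close> decrease by the same amount, the quotient does
  not decrease. The denominator cannot reach \<open>0\<close>, as \<open>A\<close> would then be stable under some
  element of \<open>B\<close>.\<close>

lemma (in comm_group) dyson_transform_stable:
  assumes "finite S" "finite R" "S \<subseteq> carrier G" "R \<subseteq> carrier G" "\<one> \<in> R"
  shows "\<exists>S' R'. S' \<subseteq> S <#> R \<and> R' \<subseteq> R \<and> \<one> \<in> R' \<and> S' <#> R' = S'
           \<and> card S' + card R' = card S + card R"
  using assms
proof (induction "card R" arbitrary: S R rule: less_induct)
  case less
  have sub: "S \<subseteq> S <#> R"
  proof
    fix s assume "s \<in> S"
    then have "s = s \<otimes> \<one>" using less.prems by auto
    then show "s \<in> S <#> R" using \<open>s \<in> S\<close> less.prems unfolding set_mult_def by blast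
  qed
  show ?case
  proof (cases "S <#> R = S")
    case True
    then show ?thesis using less.prems by (intro exI[of _ S] exI[of _ R]) auto
  next
    case False
    \<comment> \<open>Since \<open>\<one> \<in> R\<close> gives S \<subseteq> SR, instability means
      that some product \<open>s \<otimes> r\<close> leaves \<open>S\<close>. Transforming by this
      \<open>s\<close> removes \<open>r\<close> from \<open>R\<close>, so the induction measure
      drops strictly; \<open>\<one>\<close> survives because \<open>s \<in> S\<close>.\<close>
    then obtain s r where sr: "s \<in> S" "r \<in> R" "s \<otimes> r \<notin> S"
      using sub unfolding set_mult_def by blast
    have sc: "s \<in> carrier G" using sr less.prems by auto
    define S1 where "S1 = S \<union> (\<lambda>x. s \<otimes> x) ` R"
    define R1 where "R1 = {x \<in> R. s \<otimes> x \<in> S}"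
    have inj: "inj_on (\<lambda>x. s \<otimes> x) R"
      using sc less.prems by (auto simp: inj_on_def subset_iff)
    \<comment> \<open>What the union with sR gains over \<open>S\<close> is exactly what
      \<open>R1\<close> loses from \<open>R\<close>, by inclusion-exclusion.\<close>
    have inter: "S \<inter> (\<lambda>x. s \<otimes> x) ` R = (\<lambda>x. s \<otimes> x) ` R1"
      by (auto simp: R1_def)
    have R1: "R1 \<subseteq> R" "R1 \<noteq> R" using sr by (auto simp: R1_def)
    have "card ((\<lambda>x. s \<otimes> x) ` R1) = card R1" "card ((\<lambda>x. s \<otimes> x) ` R) = card R"
      using inj inj_on_subset[OF inj R1(1)] by (auto simp: card_image)
    then have cards: "card S1 + card R1 = card S + card R"
      using card_Un_Int[of S "(\<lambda>x. s \<otimes> x) ` R"] less.prems inter by (simp add: S1_def)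
    have prod: "S1 <#> R1 \<subseteq> S <#> R"
    proof
      fix z assume "z \<in> S1 <#> R1"
      then obtain x y where xy: "x \<in> S1" "y \<in> R" "s \<otimes> y \<in> S" "z = x \<otimes> y"
        by (auto simp: set_mult_def R1_def)
      show "z \<in> S <#> R"
      proof (cases "x \<in> S")
        case True
        then show ?thesis using xy by (auto simp: set_mult_def)
      next
        case False
        then obtain t where t: "t \<in> R" "x = s \<otimes> t" using xy by (auto simp: S1_def)
        then have "t \<in> carrier G" "y \<in> carrier G" using xy less.prems by auto
        \<comment> \<open>Commutativity enters here: \<open>s\<close> moves from \<open>t\<close> to
          \<open>y\<close>, and \<open>s \<otimes> y\<close> lies in \<open>S\<close> by the choice
          of \<open>R1\<close>.\<close>
        then have "z = (s \<otimes> y) \<otimes> t" using sc t xy by (simp add: m_ac)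
        then show ?thesis using xy t unfolding set_mult_def by blast
      qed
    qed
    have "card R1 < card R" using R1 less.prems by (simp add: psubset_card_mono psubsetI)
    moreover have "finite S1" "finite R1" "S1 \<subseteq> carrier G" "R1 \<subseteq> carrier G" "\<one> \<in> R1"
      using less.prems sc sr by (auto simp: S1_def R1_def subset_iff)
    ultimately obtain S' R' where
      "S' \<subseteq> S1 <#> R1" "R' \<subseteq> R1" "\<one> \<in> R'" "S' <#> R' = S'"
      "card S' + card R' = card S1 + card R1"
      using less.hyps[of R1 S1] by blast
    then show ?thesis using prod R1(1) cards
      by (intro exI[of _ S'] exI[of _ R']) auto
  qed
qed

text \<open>When a fraction above 1 loses equal amounts above and below, the loss is proportionally
  heavier on the smaller term, the denominator. The primed numbers are those after the Dyson
  transforms.\<close>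

lemma nat_ceiling_divide_mono:
  fixes u d u' d' :: nat
  assumes "d' + u \<le> d + u'" "u' \<le> u" "d < u" "0 < d'"
  shows "nat \<lceil>real u / real d\<rceil> \<le> nat \<lceil>real u' / real d'\<rceil>"
proof (cases "d = 0")
  case False
  have d: "real d' + real u \<le> real d + real u'" using assms by linarith
  \<comment> \<open>The second factor is positive, since \<open>u' - d' \<ge> u - d > 0\<close>.
    Adding the next inequality cancels every term except \<open>u * d'\<close> and
    \<open>u' * d\<close>.\<close>
  have "0 \<le> (real u - real u') * (real u' - real d')"
    using assms d by (intro mult_nonneg_nonneg) linarith+
  moreover have "real u' * real d' + real u' * real u \<le> real u' * real d + real u' * real u'"
    using mult_left_mono[OF d, of "real u'"] by (simp add: algebra_simps)
  ultimately have "real u * real d' \<le> real u' * real d" by (simp add: algebra_simps)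
  then have "real u / real d \<le> real u' / real d'"
    using False assms by (simp add: divide_simps)
  then show ?thesis by (intro nat_mono ceiling_mono)
\<comment> \<open>For \<open>d = 0\<close> the left quotient is \<open>0\<close> by the convention
  for division by zero.\<close>
qed simp

text \<open>The harder of the two inequalities between the maxima. It treats every proper subset
  \<open>S\<close>, not only a maximizing one, so that the maxima can be compared term by
  term.\<close>

lemma (in comm_group) stable_pair_dominates:
  assumes A: "A \<subseteq> carrier G" "finite A" "A \<noteq> {}"
    and B: "B \<subseteq> carrier G" "finite B" "card A = card B" "\<one> \<notin> B"
    and nostab: "\<forall>x\<in>B. A #> x \<noteq> A"
    and S: "S \<subset> A"
  shows "\<exists>S' R. S' \<subseteq> A \<and> R \<subseteq> B \<union> {\<one>} \<and> S' <#> R = S' \<and> S' \<noteq> A \<and>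
      nat \<lceil>real (card (right_translates_into G A B S)) / (real (card A) - real (card S))\<rceil>
      \<le> nat \<lceil>real (card (R - {\<one>})) / (real (card A) - real (card S'))\<rceil>"
proof -
  define U where "U = right_translates_into G A B S"
  define d where "d = card A - card S"
  have cS: "card S < card A" using S A by (simp add: psubset_card_mono)
  have d: "real (card A) - real (card S) = real d" using cS by (simp add: d_def of_nat_diff)
  have U: "U \<subseteq> B" "finite U" "\<one> \<notin> U"
    using B by (auto simp: U_def right_translates_into_def)
  show ?thesis
  proof (cases "card U \<le> d")
    case True
    have "real (card U) / real d \<le> 1" using True by (simp add: divide_simps)
    \<comment> \<open>The pair of \<open>{}\<close> and \<open>B \<union> {\<one>}\<close> has
      quotient |B| / |A| = 1, which suffices when \<open>card U \<le> d\<close>.\<close>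
    moreover have "real (card ((B \<union> {\<one>}) - {\<one>})) / (real (card A) - real (card ({}::'a set))) = 1"
      using A B by simp (metis card_0_eq card.empty)
    ultimately have "nat \<lceil>real (card U) / real d\<rceil>
        \<le> nat \<lceil>real (card ((B \<union> {\<one>}) - {\<one>})) / (real (card A) - real (card ({}::'a set)))\<rceil>"
      by (metis ceiling_mono nat_mono)
    then show ?thesis using A unfolding U_def[symmetric] d
      by (intro exI[of _ "{}"] exI[of _ "B \<union> {\<one>}"]) (auto simp: set_mult_def)
  next
    case False
    define R where "R = insert \<one> U"
    have fin: "finite S" using S A finite_subset by blast
    have SRA: "S <#> R \<subseteq> A"
    proof
      fix z assume "z \<in> S <#> R"
      then obtain s r where sr: "s \<in> S" "r \<in> R" "z = s \<otimes> r" by (auto simp: set_mult_def)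
      have "s \<in> A" "s \<in> carrier G" using sr S A by auto
      then show "z \<in> A" using sr
        by (auto simp: R_def U_def right_translates_into_def r_coset_def)
    qed
    have R_props: "finite R" "S \<subseteq> carrier G" "R \<subseteq> carrier G" "\<one> \<in> R"
      using U B S A by (auto simp: R_def)
    obtain S' R' where S': "S' \<subseteq> S <#> R" "R' \<subseteq> R" "\<one> \<in> R'" "S' <#> R' = S'"
        "card S' + card R' = card S + card R"
      using dyson_transform_stable[OF fin R_props] by metis
    have S'A: "S' \<subseteq> A" using S'(1) SRA by (rule subset_trans)
    have finR': "finite R'" using S'(2) R_props(1) by (rule finite_subset)
    define r where "r = card (R' - {\<one>})"
    have cR': "card R' = Suc r" using card.remove[OF finR' S'(3)] by (simp add: r_def)
    have cR: "card R = Suc (card U)" using U by (simp add: R_def)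
    have ru: "r \<le> card U" unfolding r_def
      using S'(2) U by (intro card_mono) (auto simp: R_def)
    have bal: "card S' + r = card S + card U" using S'(5) cR cR' by simp
    have "S' \<noteq> A"
    proof
      assume eq: "S' = A"
      \<comment> \<open>If \<open>S'\<close> were all of \<open>A\<close>, the balance would read
        |A| + r = |S| + |U|, and |U| > |A| - |S| would leave a non-identity \<open>x\<close> in
        \<open>R'\<close>. Then Ax \<subseteq> A with equal sizes, so \<open>x\<close> stabilizes
        \<open>A\<close>, against \<open>nostab\<close>.\<close>
      have "r > 0" using bal[unfolded eq] False cS unfolding d_def by linarith
      then obtain x where x: "x \<in> R'" "x \<noteq> \<one>" unfolding r_def card_gt_0_iff by auto
      then have xB: "x \<in> B" using S'(2) U by (auto simp: R_def)
      have "A #> x \<subseteq> A <#> R'" using x(1) by (auto simp: set_mult_def r_coset_def)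
      then have "A #> x \<subseteq> A" using S'(4) eq by simp
      moreover have "card (A #> x) = card A"
        using card_rcosets_equal[OF rcosetsI[OF A(1)] A(1)] B(1) xB by auto
      ultimately have "A #> x = A" using A by (simp add: card_subset_eq)
      then show False using nostab xB by blast
    qed
    then have cS': "card S' < card A" using S'A A by (simp add: psubset_card_mono psubsetI)
    have d': "real (card A) - real (card S') = real (card A - card S')"
      using cS' by (simp add: of_nat_diff)
    \<comment> \<open>By \<open>bal\<close>, numerator and denominator have both decreased by |U| -
      r.\<close>
    have "nat \<lceil>real (card U) / real d\<rceil> \<le> nat \<lceil>real r / real (card A - card S')\<rceil>"
      using bal ru cS cS' False by (intro nat_ceiling_divide_mono) (auto simp: d_def)
    moreover have "R' \<subseteq> B \<union> {\<one>}" using S'(2) U(1) by (auto simp: R_def)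
    ultimately show ?thesis using S'A \<open>S' \<noteq> A\<close> S'(4)
      unfolding U_def[symmetric] d r_def d'[symmetric] by blast
  qed
qed

theorem theorem5p3:
  fixes G :: "('a, 'm) monoid_scheme" (structure)
    and A B :: "'a set"
  assumes "comm_group G"
    and "A \<subseteq> carrier G" and "B \<subseteq> carrier G"
    and "finite A" and "finite B"
    and "A \<noteq> {}" and "B \<noteq> {}"
    and "card A = card B"
    and "\<one> \<notin> B"
    and "right_partition_number G A B < \<infinity>"
  shows "right_partition_number G A B =
    enat (Max {nat \<lceil>real (card (R - {\<one>})) / (real (card A) - real (card S))\<rceil> | S R.
                 S \<subseteq> A \<and> R \<subseteq> B \<union> {\<one>} \<and> S <#> R = S \<and> S \<noteq> A})"
proof -
  interpret comm_group G by fact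
  define f where "f S = nat \<lceil>real (card (right_translates_into G A B S)) /
      (real (card A) - real (card S))\<rceil>" for S
  define g where "g S R = nat \<lceil>real (card (R - {\<one>})) / (real (card A) - real (card S))\<rceil>"
    for S R :: "'a set"
  let ?F = "{f S | S. S \<subset> A}"
  let ?G = "{g S R | S R. S \<subseteq> A \<and> R \<subseteq> B \<union> {\<one>} \<and> S <#> R = S \<and> S \<noteq> A}"
  have nostab: "\<forall>x\<in>B. A #> x \<noteq> A"
    using assms(10) by (auto simp: right_partition_number_def split: if_splits)
  have "finite (f ` Pow A)" using assms by simp
  then have finF: "finite ?F" by (rule rev_finite_subset) auto
  have "finite ((\<lambda>(S, R). g S R) ` (Pow A \<times> Pow (B \<union> {\<one>})))" using assms by simp
  then have finG: "finite ?G" by (rule rev_finite_subset) auto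
  have "f {} \<in> ?F" using assms by blast
  then have neF: "?F \<noteq> {}" by blast
  have "g {} {} \<in> ?G" using assms by (auto simp: set_mult_def)
  then have neG: "?G \<noteq> {}" by blast
  have "Max ?F \<le> Max ?G"
  proof (rule Max.boundedI[OF finF neF])
    fix v assume "v \<in> ?F"
    then obtain S where S: "S \<subset> A" "v = f S" by blast
    obtain S' R where "S' \<subseteq> A" "R \<subseteq> B \<union> {\<one>}" "S' <#> R = S'" "S' \<noteq> A" "f S \<le> g S' R"
      using stable_pair_dominates[OF _ _ _ _ _ _ _ nostab S(1)] assms unfolding f_def g_def by blast
    then have "g S' R \<in> ?G" "v \<le> g S' R" using S by auto
    then show "v \<le> Max ?G" using Max_ge[OF finG] order_trans by blast
  qed
  moreover have "Max ?G \<le> Max ?F"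
  proof (rule Max.boundedI[OF finG neG])
    fix v assume "v \<in> ?G"
    then obtain S R where SR: "S \<subseteq> A" "R \<subseteq> B \<union> {\<one>}" "S <#> R = S" "S \<noteq> A" "v = g S R"
      by blast
    \<comment> \<open>For the converse inequality the same \<open>S\<close> serves: stability gives
      Sb \<subseteq> SR = S \<subseteq> A, so the non-identity part of \<open>R\<close> lies among
      the translates counted by \<open>f S\<close>.\<close>
    have "b \<in> right_translates_into G A B S" if "b \<in> R - {\<one>}" for b
    proof -
      have "S #> b \<subseteq> S <#> R" using that by (auto simp: set_mult_def r_coset_def)
      then show ?thesis using that SR by (auto simp: right_translates_into_def)
    qed
    then have "card (R - {\<one>}) \<le> card (right_translates_into G A B S)"
      using assms by (intro card_mono) (auto simp: right_translates_into_def)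
    moreover have "card S \<le> card A" using card_mono[OF assms(4) SR(1)] .
    ultimately have "v \<le> f S" unfolding SR(5) f_def g_def
      by (intro nat_mono ceiling_mono divide_right_mono) auto
    moreover have "f S \<in> ?F" using SR by blast
    ultimately show "v \<le> Max ?F" using Max_ge[OF finF] order_trans by blast
  qed
  ultimately have "Max ?F = Max ?G" by (rule antisym)
  moreover have "right_partition_number G A B = enat (Max ?F)"
    using nostab by (auto simp: right_partition_number_def f_def)
  ultimately show ?thesis unfolding g_def by simp
qed

end
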